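(* Let $d,n\ge 1$ be integers, let $L,\eta,\sigma,C_s>0$, let $D>\frac{\eta L}{2n}$, and let $\mathcal{O}$ be a $C_s$-anti-concentrated oracle on $\mathbb{R}^d$ (with parameter $L$). Then there exist a data universe $\mathcal{U}$ and a loss function $\mathcal{L}:\mathbb{R}^d\times\mathcal{U}^n\to\mathbb{R}$ such that for every dataset $\mathcal{X}\in\mathcal{U}^n$ the function $w\mapsto\mathcal{L}(w;\mathcal{X})$ is linear and $L$-Lipschitz on $[-D,D]^d$, and such that for every integer $T\ge1$ the algorithm that runs $T$ steps of projected stochastic zeroth-order descent with oracle $\mathcal{O}$, step size $\eta$, constraint set $[-D,D]^d$ and initialization $w_0\sim\mathcal{N}(0,\sigma^2 I_d)$, and outputs only the final iterate $w_T$, is not $(\varepsilon,\delta)$-differentially private for any $\varepsilon\ge0$, $\delta\in[0,1)$ satisfying $$\delta\le\frac{1}{16C_s}\max\left\{\frac1{T^{2/3}},\frac{\eta L}{2nD}\right\}\quad\text{and}\quad \varepsilon\le\min\left\{\frac{\eta^2L^2T^{4/3}}{8n^2\sigma^2},\frac{D^2}{2\sigma^2}\right\}+\ln\left(\frac{\sqrt{2\pi}\,L\eta}{64\,C_s\,n\,\sigma}\right).$$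
   Context: An (update) oracle $\mathcal{O}$ on $\mathbb{R}^d$ takes a function $f:\mathbb{R}^d\to\mathbb{R}$ and a point $w\in\mathbb{R}^d$ and returns a (Borel) probability measure $\mathcal{O}(f,w)$ on $\mathbb{R}^d$, depending measurably on $w$. For $v\in\mathbb{R}^d$, $\{v\}_i$ denotes its $i$-th coordinate, and $\mathbf{e}_i$ is the $i$-th standard basis vector. For $L>0$, an oracle $\mathcal{O}$ is $C_s$-anti-concentrated ($C_s$-AC) if there is an index $i^*\in\{1,\dots,d\}$ such that, with $\mathcal{F}=\{w\mapsto\langle g\,\mathbf{e}_{i^*},w\rangle:-L\le g\le0\}$, for every $h\in\mathcal{F}$ and $\overline w\in\mathbb{R}^d$, if $U\sim\mathcal{O}(h,\overline w)$ then (all expectations below being finite): (1) $\{\nabla h(\overline w)\}_{i^*}=0$ implies $\mathbb{P}[U=\mathbf{0}_d]=1$; (2) $\{\nabla h(\overline w)\}_{i^*}\ne0$ implies $\mathbb{P}[\{U\}_{i^*}<0]=1$; (3) $\mathbb{E}[\{U\}_{i^*}]\le\{\nabla h(\overline w)\}_{i^*}$; (4) for any $w_1,\dots,w_N\in\mathbb{R}^d$, if $U_j\sim\mathcal{O}(h,w_j)$ independently for $j=1,\dots,N$, then $\mathbb{E}\big[\big(\sum_{j=1}^N\{U_j\}_{i^*}\big)^2\big]\le C_s\big(\mathbb{E}\big[\sum_{j=1}^N\{U_j\}_{i^*}\big]\big)^2$. Projected stochastic zeroth-order descent on a dataset $\mathcal{X}$ with oracle $\mathcal{O}$, step size $\eta>0$,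 closed convex constraint set $C$ and initialization distribution $\mathcal{R}_{init}$: sample $w_0\sim\mathcal{R}_{init}$; for $t=1,\dots,T$, draw (with fresh randomness, given $w_{t-1}$) $G_t\sim\mathcal{O}(\mathcal{L}(\cdot;\mathcal{X}),w_{t-1})$ and set $w_t=\Pi_C(w_{t-1}-\eta G_t)$, where $\Pi_C(x)=\arg\min_{u\in C}\|x-u\|_2$. Two datasets of the same size $n$ are neighbouring if they differ in exactly one record (their symmetric difference, as multisets, has size $2$). A randomized algorithm $\mathcal{A}$ is $(\varepsilon,\delta)$-differentially private, $\varepsilon\ge 0$, $\delta\in[0,1)$, if $\mathbb{P}(\mathcal{A}(\mathcal{D})\in O)\le e^{\varepsilon}\mathbb{P}(\mathcal{A}(\mathcal{D}')\in O)+\delta$ for all neighbouring datasets $\mathcal{D},\mathcal{D}'$ and all measurable sets $O$. A function $g$ is $L$-Lipschitz on $C$ if $|g(x)-g(y)|\le L\|x-y\|_2$ for all $x,y\in C$. *)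

theory Defs
  imports "HOL-Probability.Probability" "HOL-Library.Multiset"
begin

definition gradient :: "('a::real_inner \<Rightarrow> real) \<Rightarrow> 'a \<Rightarrow> 'a" where
  "gradient f x = (THE v. GDERIV f x :> v)"

lemma gradient_inner_left [simp]: "gradient (\<lambda>w. a \<bullet> w) x = a"
proof -
  have g: "GDERIV (\<lambda>w. a \<bullet> w) x :> a"
    unfolding gderiv_def
    by (auto intro!: derivative_eq_intros simp: inner_commute)
  have "v = a" if "GDERIV (\<lambda>w. a \<bullet> w) x :> v" for v
  proof -
    have "(\<lambda>h. h \<bullet> v) = (\<lambda>h. h \<bullet> a)"
      using that g unfolding gderiv_def by (rule has_derivative_unique)
    then have "(v - a) \<bullet> v = (v - a) \<bullet> a"
      by meson
    then have "(v - a) \<bullet> (v - a) = 0"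
      by (simp add: inner_diff_right)
    then show ?thesis
      by simp
  qed
  then show ?thesis
    unfolding gradient_def using g by (intro the_equality)
qed

type_synonym 'd update_oracle = "(real^'d \<Rightarrow> real) \<Rightarrow> real^'d \<Rightarrow> (real^'d) measure"

definition is_oracle :: "'d::finite update_oracle \<Rightarrow> bool" where
  "is_oracle orc \<longleftrightarrow> (\<forall>f. orc f \<in> borel \<rightarrow>\<^sub>M prob_algebra borel)"

definition lin_class :: "real \<Rightarrow> 'd::finite \<Rightarrow> (real^'d \<Rightarrow> real) set" where
  "lin_class L i = {(\<lambda>w. (g *\<^sub>R axis i 1) \<bullet> w) | g. - L \<le> g \<and> g \<le> 0}"

text \<open>
  In the last clause the joint law of independent draws from \<open>orc h (w 1), \<dots>, orc h (w N)\<close> is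
  the product measure.  The integrability clauses say that the expectations
  are finite; they are needed because the Bochner integral of a non-integrable function is 0.
\<close>

definition anti_concentrated :: "real \<Rightarrow> real \<Rightarrow> 'd::finite update_oracle \<Rightarrow> bool" where
  "anti_concentrated L C\<^sub>s orc \<longleftrightarrow>
     (\<exists>i. \<forall>h \<in> lin_class L i. \<forall>w\<^sub>0.
        (gradient h w\<^sub>0 $ i = 0 \<longrightarrow> \<P>(u in orc h w\<^sub>0. u = 0) = 1) \<and>
        (gradient h w\<^sub>0 $ i \<noteq> 0 \<longrightarrow> \<P>(u in orc h w\<^sub>0. u $ i < 0) = 1) \<and>
        integrable (orc h w\<^sub>0) (\<lambda>u. u $ i) \<and>
        (\<integral>u. u $ i \<partial>orc h w\<^sub>0) \<le> gradient h w\<^sub>0 $ i \<and>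
        (\<forall>(N::nat) (w :: nat \<Rightarrow> real^'d).
           let P = (\<Pi>\<^sub>M j\<in>{1..N}. orc h (w j)) in
             integrable P (\<lambda>u. \<Sum>j=1..N. u j $ i) \<and>
             integrable P (\<lambda>u. (\<Sum>j=1..N. u j $ i)\<^sup>2) \<and>
             (\<integral>u. (\<Sum>j=1..N. u j $ i)\<^sup>2 \<partial>P) \<le> C\<^sub>s * (\<integral>u. (\<Sum>j=1..N. u j $ i) \<partial>P)\<^sup>2))"

text \<open>The Gaussian with covariance \<open>\<sigma>\<^sup>2 I\<close>: independent coordinates, each with
  standard deviation \<open>\<sigma>\<close> (the second argument of \<^const>\<open>normal_density\<close>).\<close>

definition isotropic_gaussian :: "real \<Rightarrow> (real^'d::finite) measure" where
  "isotropic_gaussian \<sigma> =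
     distr (\<Pi>\<^sub>M i\<in>UNIV. density lborel (\<lambda>x. ennreal (normal_density 0 \<sigma> x))) borel (\<lambda>x. \<chi> i. x i)"

text \<open>Law of the iterate \<open>w\<^sub>t\<close>; the monadic bind draws \<open>G\<^sub>t\<close> freshly from the oracle at the
  current iterate.  \<^const>\<open>closest_point\<close> is the Euclidean projection, and the initial
  iterate is not projected.\<close>

primrec psgd :: "'d::finite update_oracle \<Rightarrow> (real^'d \<Rightarrow> real) \<Rightarrow> real \<Rightarrow> (real^'d) set \<Rightarrow>
    (real^'d) measure \<Rightarrow> nat \<Rightarrow> (real^'d) measure" where
  "psgd orc f \<eta> C R 0 = R"
| "psgd orc f \<eta> C R (Suc t) =
     psgd orc f \<eta> C R t \<bind> (\<lambda>w. distr (orc f w) borel (\<lambda>g. closest_point C (w - \<eta> *\<^sub>R g)))"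

definition datasets :: "'u set \<Rightarrow> nat \<Rightarrow> 'u list set" where
  "datasets U n = {X. set X \<subseteq> U \<and> length X = n}"

text \<open>Both differences are needed: multiset subtraction truncates.\<close>

definition neighbouring :: "'u list \<Rightarrow> 'u list \<Rightarrow> bool" where
  "neighbouring X Y \<longleftrightarrow> length X = length Y \<and>
     size (mset X - mset Y) + size (mset Y - mset X) = 2"

definition differentially_private ::
    "'u set \<Rightarrow> nat \<Rightarrow> real \<Rightarrow> real \<Rightarrow> ('u list \<Rightarrow> 'b::topological_space measure) \<Rightarrow> bool" where
  "differentially_private U n \<epsilon> \<delta> A \<longleftrightarrow>
     (\<forall>X \<in> datasets U n. \<forall>Y \<in> datasets U n. neighbouring X Y \<longrightarrow>
        (\<forall>S \<in> sets borel. measure (A X) S \<le> exp \<epsilon> * measure (A Y) S + \<delta>))"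

end

theory Submission
  imports Defs "HOL-Real_Asymp.Real_Asymp"
begin

text \<open>
  Let \<open>i\<close> be the index provided by anti-concentration, take records in \<open>{0, 1}\<close>, and let the loss be
  \<open>w \<mapsto> - (L/n) k w\<^sub>i\<close>, where \<open>k\<close> is the number of records equal to \<open>1\<close>.  On the dataset \<open>X\<close>
  consisting of zeros the gradient vanishes, so the oracle never moves and \<open>w\<^sub>T\<close> is the projection of
  \<open>w\<^sub>0\<close>.  On the neighbouring dataset \<open>Y\<close> with a single \<open>1\<close> the \<open>i\<close>-th coordinate drifts upwards by
  at least \<open>m = \<eta>L/n\<close> per step in expectation.  The two output laws are compared on
  \<open>S = {x. \<tau> \<le> x\<^sub>i}\<close> with \<open>\<tau> = min D (m T\<^bsup>2/3\<^esup> / 2)\<close>.  Since \<open>0 < \<tau> \<le> D\<close>, projecting onto the cube does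
  not change membership in \<open>S\<close>.

  Under \<open>X\<close>, \<open>S\<close> has the probability of a Gaussian tail, which is at most
  \<open>\<sigma> / (\<tau> \<surd>(2\<pi>)) \<sqdot> exp (- \<tau>\<^sup>2 / (2\<sigma>\<^sup>2))\<close>; by the bounds on \<open>\<epsilon>\<close> and \<open>\<delta>\<close>, privacy would give
  \<open>S\<close> probability at most \<open>(3 / (32 C\<^sub>s)) \<sqdot> m / (2\<tau>) \<le> 3 / (32 C\<^sub>s)\<close> under \<open>Y\<close>.

  Under \<open>Y\<close>, however, \<open>S\<close> has probability at least \<open>1 / (8 C\<^sub>s)\<close>: with probability \<open>1/2\<close> the chain
  starts at \<open>w\<^sub>0\<close> with nonnegative \<open>i\<close>-th coordinate, and then it reaches \<open>S\<close> with probability at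
  least \<open>1 / (4 C\<^sub>s)\<close> (lemma \<open>reach_prob_ge\<close>).  The latter is a Paley--Zygmund argument, but the
  increments of the chain are dependent, because each is drawn at the current iterate.  Two devices
  deal with this.  First, a positive increment whose conditional mean \<open>e\<close> exceeds \<open>m\<close> may be
  shrunk by the factor \<open>m / e\<close>: that only delays the chain, and afterwards all
  increments \<open>v\<close> have conditional mean exactly \<open>m\<close> and conditional second moment at most \<open>C\<^sub>s m\<^sup>2\<close>.
  As \<open>C\<^sub>s \<ge> 1\<close>, their sum \<open>Z\<close> satisfies \<open>E Z = T m\<close> and \<open>E Z\<^sup>2 \<le> C\<^sub>s (T m)\<^sup>2\<close>, as for independent
  increments; the second-moment condition is needed for single draws only.  Secondly, as the shrunk sum is not a function of the iterate, the
  inequality is proved by backward induction on the number of remaining steps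
  (lemma \<open>reach_prob_ge_quadratic\<close>), starting from the quadratic minorant
  \<open>2l(z - a) - l\<^sup>2 z\<^sup>2\<close> of the indicator of \<open>z \<ge> a\<close>.
\<close>

section \<open>Projection onto a cube\<close>

lemma closest_point_cube_nth:
  fixes x :: "real^'d::finite"
  assumes "D \<ge> 0"
  shows "closest_point (cbox (\<chi> i. - D) (\<chi> i. D)) x $ j = max (- D) (min D (x $ j))"
proof -
  let ?C = "cbox (\<chi> i. - D) (\<chi> i. D) :: (real^'d) set"
  define p :: "real^'d" where "p = (\<chi> i. max (- D) (min D (x $ i)))"
  have "p = closest_point ?C x"
  proof (rule closest_point_unique)
    show "p \<in> ?C" using assms by (auto simp: p_def mem_box_cart)
    show "\<forall>z\<in>?C. dist x p \<le> dist x z"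
    proof
      fix z assume "z \<in> ?C"
      then have "- D \<le> z $ i \<and> z $ i \<le> D" for i by (auto simp: mem_box_cart)
      then have "norm ((x - p) $ i) \<le> norm ((x - z) $ i)" for i
        by (auto simp: p_def max_def min_def abs_if dest: spec[of _ i])
           (smt (verit))+
      then show "dist x p \<le> dist x z"
        unfolding dist_norm by (rule norm_le_componentwise_cart)
    qed
  qed auto
  then show ?thesis by (metis p_def vec_lambda_beta)
qed

lemma borel_measurable_closest_point:
  fixes C :: "'a::euclidean_space set"
  assumes "convex C" "closed C" "C \<noteq> {}"
  shows "closest_point C \<in> borel_measurable borel"
  by (intro borel_measurable_continuous_onI continuous_on_closest_point assms)

section \<open>Projected descent as a Markov chain\<close>

text \<open>One step of projected descent from \<open>w\<close>, as a Markov kernel; \<open>Q w\<close> is the law of the update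
  drawn at \<open>w\<close>.\<close>

definition psgd_step :: "(real^'d \<Rightarrow> (real^'d) measure) \<Rightarrow> real \<Rightarrow> (real^'d) set \<Rightarrow>
    real^'d \<Rightarrow> (real^'d::finite) measure" where
  "psgd_step Q \<eta> C w = distr (Q w) borel (\<lambda>g. closest_point C (w - \<eta> *\<^sub>R g))"

lemma measurable_psgd_step:
  assumes "Q \<in> borel \<rightarrow>\<^sub>M prob_algebra borel" "convex C" "closed C" "C \<noteq> {}"
  shows "psgd_step Q \<eta> C \<in> borel \<rightarrow>\<^sub>M prob_algebra borel"
proof -
  note borel_measurable_closest_point[OF assms(2-4), measurable]
  show ?thesis
    unfolding psgd_step_def[abs_def]
    by (rule measurable_distr_prob_space2[OF assms(1)]) measurable
qed

lemma psgd_in_prob_algebra: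
  assumes "orc f \<in> borel \<rightarrow>\<^sub>M prob_algebra borel" "convex C" "closed C" "C \<noteq> {}"
    and "R \<in> space (prob_algebra borel)"
  shows "psgd orc f \<eta> C R t \<in> space (prob_algebra borel)"
proof (induction t)
  case (Suc t)
  have "(\<lambda>R. R \<bind> psgd_step (orc f) \<eta> C) \<in> prob_algebra borel \<rightarrow>\<^sub>M prob_algebra borel"
    by (rule measurable_bind_prob_space[OF _ measurable_psgd_step[OF assms(1-4)]]) simp
  from measurable_space[OF this Suc] show ?case
    by (simp add: psgd_step_def[abs_def])
qed (use assms in simp)

lemma nn_integral_psgd_Suc:
  assumes "orc f \<in> borel \<rightarrow>\<^sub>M prob_algebra borel" "convex C" "closed C" "C \<noteq> {}"
    and "R \<in> space (prob_algebra borel)" and "F \<in> borel_measurable borel"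
  shows "(\<integral>\<^sup>+w. F w \<partial>psgd orc f \<eta> C R (Suc t)) =
         (\<integral>\<^sup>+w. \<integral>\<^sup>+y. F y \<partial>psgd_step (orc f) \<eta> C w \<partial>psgd orc f \<eta> C R t)"
proof -
  have s: "sets (psgd orc f \<eta> C R t) = sets borel"
    using psgd_in_prob_algebra[of orc f C R, OF assms(1-5)] by (simp add: space_prob_algebra)
  have "psgd_step (orc f) \<eta> C \<in> psgd orc f \<eta> C R t \<rightarrow>\<^sub>M subprob_algebra borel"
    using measurable_prob_algebraD[OF measurable_psgd_step[OF assms(1-4)]]
    by (simp add: measurable_cong_sets[OF s refl])
  from nn_integral_bind[OF assms(6) this] show ?thesis
    by (simp add: psgd_step_def[abs_def])
qed

text \<open>The probability that the chain with kernel \<open>K\<close> started at \<open>w\<close> is in \<open>S\<close> after \<open>k\<close> steps,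
  computed by conditioning on the first step.  While \<^const>\<open>psgd\<close> appends steps at the end, this
  recursion prepends them, as backward induction requires.\<close>

primrec reach_prob :: "('a \<Rightarrow> 'a measure) \<Rightarrow> 'a set \<Rightarrow> nat \<Rightarrow> 'a \<Rightarrow> ennreal" where
  "reach_prob K S 0 w = indicator S w"
| "reach_prob K S (Suc k) w = (\<integral>\<^sup>+y. reach_prob K S k y \<partial>K w)"

lemma borel_measurable_reach_prob:
  assumes "K \<in> M \<rightarrow>\<^sub>M prob_algebra M" "S \<in> sets M"
  shows "reach_prob K S k \<in> borel_measurable M"
proof (induction k)
  case (Suc k)
  then show ?case
    using measurable_compose[OF measurable_prob_algebraD[OF assms(1)]
        nn_integral_measurable_subprob_algebra[OF Suc]]
    by (simp cong: measurable_cong)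
qed (use assms in \<open>simp cong: measurable_cong\<close>)

lemma emeasure_psgd_eq_reach_prob:
  assumes "orc f \<in> borel \<rightarrow>\<^sub>M prob_algebra borel" "convex C" "closed C" "C \<noteq> {}"
    and "R \<in> space (prob_algebra borel)" and "S \<in> sets borel"
  shows "emeasure (psgd orc f \<eta> C R T) S = (\<integral>\<^sup>+w. reach_prob (psgd_step (orc f) \<eta> C) S T w \<partial>R)"
proof -
  let ?F = "reach_prob (psgd_step (orc f) \<eta> C) S"
  have mF: "?F k \<in> borel_measurable borel" for k
    by (intro borel_measurable_reach_prob measurable_psgd_step assms)
  have "(\<integral>\<^sup>+w. ?F k w \<partial>psgd orc f \<eta> C R t) = (\<integral>\<^sup>+w. ?F (k + t) w \<partial>R)" for k t
  proof (induction t arbitrary: k)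
    case (Suc t)
    have "(\<integral>\<^sup>+w. ?F k w \<partial>psgd orc f \<eta> C R (Suc t)) = (\<integral>\<^sup>+w. ?F (Suc k) w \<partial>psgd orc f \<eta> C R t)"
      using nn_integral_psgd_Suc[of orc f C R, OF assms(1-5) mF] by simp
    with Suc[of "Suc k"] show ?case by simp
  qed simp
  from this[where k = 0 and t = T] have "(\<integral>\<^sup>+w. indicator S w \<partial>psgd orc f \<eta> C R T) = (\<integral>\<^sup>+w. ?F T w \<partial>R)"
    by (simp del: nn_integral_indicator cong: nn_integral_cong)
  moreover have "sets (psgd orc f \<eta> C R T) = sets borel"
    using psgd_in_prob_algebra[of orc f C R, OF assms(1-5)] by (simp add: space_prob_algebra)
  ultimately show ?thesis using assms(6) by simp
qed

section \<open>An adaptive Paley--Zygmund inequality\<close>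

lemma ennreal_integral_le_nn_integral:
  fixes f :: "'a \<Rightarrow> real"
  assumes "integrable M f"
  shows "ennreal (\<integral>x. f x \<partial>M) \<le> (\<integral>\<^sup>+x. ennreal (f x) \<partial>M)"
proof -
  have "(\<integral>x. f x \<partial>M) \<le> (\<integral>x. max 0 (f x) \<partial>M)"
    using assms by (intro integral_mono) auto
  then have "ennreal (\<integral>x. f x \<partial>M) \<le> ennreal (\<integral>x. max 0 (f x) \<partial>M)"
    by (rule ennreal_leI)
  also have "\<dots> = (\<integral>\<^sup>+x. ennreal (max 0 (f x)) \<partial>M)"
    using assms by (intro nn_integral_eq_integral[symmetric]) auto
  also have "\<dots> = (\<integral>\<^sup>+x. ennreal (f x) \<partial>M)"
    by (intro nn_integral_cong) (simp add: max_def ennreal_neg)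
  finally show ?thesis .
qed

text \<open>
  Here \<open>z\<close> is the sum of the shrunk increments so far, of which \<open>w $ i\<close> is only known to dominate
  the truncation at \<open>\<tau>\<close>.  The left-hand side is the bound on the conditional expectation of
  \<open>2l(Z - a) - l\<^sup>2 Z\<^sup>2\<close>, where \<open>Z\<close> is \<open>z\<close> plus \<open>k\<close> further increments with conditional mean
  \<open>m\<close> and conditional second moment at most \<open>C m\<^sup>2\<close>: the terms \<open>k C m\<^sup>2\<close> and \<open>k (k - 1) m\<^sup>2\<close> come from the
  squares and from the mixed products.
\<close>

lemma reach_prob_ge_quadratic:
  fixes Q :: "real^'d::finite \<Rightarrow> (real^'d) measure"
  assumes Q: "Q \<in> borel \<rightarrow>\<^sub>M prob_algebra borel"
    and neg: "\<And>w. AE u in Q w. u $ i < 0"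
    and int1: "\<And>w. integrable (Q w) (\<lambda>u. u $ i)"
    and int2: "\<And>w. integrable (Q w) (\<lambda>u. (u $ i)\<^sup>2)"
    and mean: "\<And>w. (\<integral>u. u $ i \<partial>Q w) \<le> - g"
    and second: "\<And>w. (\<integral>u. (u $ i)\<^sup>2 \<partial>Q w) \<le> C * (\<integral>u. u $ i \<partial>Q w)\<^sup>2"
    and pos: "g > 0" "\<eta> > 0" "l \<ge> 0"
    and \<tau>: "0 < \<tau>" "\<tau> \<le> D" "\<tau> \<le> a"
    and w: "min \<tau> z \<le> w $ i"
    and m_def: "m = \<eta> * g"
  shows "ennreal (2 * l * (z + k * m - a) -
           l\<^sup>2 * (z\<^sup>2 + 2 * z * k * m + k * C * m\<^sup>2 + k * (real k - 1) * m\<^sup>2))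
         \<le> reach_prob (psgd_step Q \<eta> (cbox (\<chi> i. - D) (\<chi> i. D))) {x. \<tau> \<le> x $ i} k w"
  using w
proof (induction k arbitrary: z w)
  case 0
  have "2 * l * (z - a) - l\<^sup>2 * z\<^sup>2 \<le> 1"
  proof -
    have "2 * l * z - (l * z)\<^sup>2 \<le> 1" using zero_le_power2[of "l * z - 1"]
      by (simp add: power2_eq_square algebra_simps)
    moreover have "0 \<le> l * a" using pos \<tau> by simp
    ultimately show ?thesis by (simp add: power_mult_distrib algebra_simps)
  qed
  moreover have "2 * l * (z - a) - l\<^sup>2 * z\<^sup>2 \<le> 0" if "\<not> \<tau> \<le> w $ i"
  proof -
    have "z \<le> a" using 0 that \<tau> by auto
    then have "l * (z - a) \<le> 0" using pos by (simp add: mult_nonneg_nonpos)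
    moreover have "0 \<le> l\<^sup>2 * z\<^sup>2" by simp
    ultimately show ?thesis by linarith
  qed
  ultimately show ?case
    by (auto simp: indicator_def ennreal_neg ennreal_le_1)
next
  case (Suc k)
  let ?C = "cbox (\<chi> i. - D) (\<chi> i. D) :: (real^'d) set"
  let ?F = "reach_prob (psgd_step Q \<eta> ?C) {x. \<tau> \<le> x $ i}"
  have D: "D \<ge> 0" using \<tau> by simp
  have C: "convex ?C" "closed ?C" "?C \<noteq> {}"
    using D by (auto simp: interval_ne_empty_cart)
  have QwM: "Q w \<in> space (prob_algebra borel)"
    using measurable_space[OF Q] by simp
  then interpret prob_space "Q w" by (simp add: space_prob_algebra)
  have [measurable_cong]: "sets (Q w) = sets borel" using QwM by (simp add: space_prob_algebra)
  define e where "e = - (\<integral>u. u $ i \<partial>Q w)"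
  have e: "e \<ge> g" "e > 0" using mean[of w] pos by (auto simp: e_def)
  \<comment> \<open>The shrunk increment is \<open>- r * u $ i\<close>: it has mean \<open>m\<close> and is at most \<open>- \<eta> * u $ i\<close>.\<close>
  define r where "r = m / e"
  have r: "0 \<le> r" "r \<le> \<eta>" "r * e = m"
    using e pos by (auto simp: r_def m_def field_simps)
  define q where "q z = 2 * l * (z + k * m - a) -
      l\<^sup>2 * (z\<^sup>2 + 2 * z * k * m + k * C * m\<^sup>2 + k * (real k - 1) * m\<^sup>2)" for z :: real
  have qeq: "q (z - r * y) = q z + (- 2 * l * r + l\<^sup>2 * (2 * z * r + 2 * r * real k * m)) * y - l\<^sup>2 * r\<^sup>2 * y\<^sup>2" for y :: real
    by (simp add: q_def power2_eq_square algebra_simps)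
  have iq: "integrable (Q w) (\<lambda>u. q (z - r * u $ i))"
    unfolding qeq using int1[of w] int2[of w] by (intro Bochner_Integration.integrable_add Bochner_Integration.integrable_diff) auto
  have "(\<integral>u. q (z - r * u $ i) \<partial>Q w) =
      q z + (- 2 * l * r + l\<^sup>2 * (2 * z * r + 2 * r * real k * m)) * (- e) - l\<^sup>2 * r\<^sup>2 * (\<integral>u. (u $ i)\<^sup>2 \<partial>Q w)"
    unfolding qeq e_def using int1[of w] int2[of w] by (simp add: prob_space)
  also have "\<dots> \<ge> q z + (- 2 * l * r + l\<^sup>2 * (2 * z * r + 2 * r * real k * m)) * (- e) - l\<^sup>2 * r\<^sup>2 * (C * e\<^sup>2)"
    using second[of w] by (intro diff_left_mono mult_left_mono) (auto simp: e_def)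
  also have "q z + (- 2 * l * r + l\<^sup>2 * (2 * z * r + 2 * r * real k * m)) * (- e) - l\<^sup>2 * r\<^sup>2 * (C * e\<^sup>2)
      = q z + 2 * l * (r * e) - l\<^sup>2 * (2 * z * (r * e) + 2 * real k * m * (r * e)) - l\<^sup>2 * C * (r * e)\<^sup>2"
    by (simp add: power_mult_distrib algebra_simps)
  also have "\<dots> = 2 * l * (z + Suc k * m - a) -
      l\<^sup>2 * (z\<^sup>2 + 2 * z * Suc k * m + Suc k * C * m\<^sup>2 + Suc k * (real (Suc k) - 1) * m\<^sup>2)"
    unfolding r q_def by (simp add: power2_eq_square algebra_simps)
  finally have "ennreal (2 * l * (z + Suc k * m - a) -
      l\<^sup>2 * (z\<^sup>2 + 2 * z * Suc k * m + Suc k * C * m\<^sup>2 + Suc k * (real (Suc k) - 1) * m\<^sup>2))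
      \<le> ennreal (\<integral>u. q (z - r * u $ i) \<partial>Q w)"
    by (rule ennreal_leI)
  also have "\<dots> \<le> (\<integral>\<^sup>+u. ennreal (q (z - r * u $ i)) \<partial>Q w)"
    by (rule ennreal_integral_le_nn_integral[OF iq])
  also have "\<dots> \<le> (\<integral>\<^sup>+u. ?F k (closest_point ?C (w - \<eta> *\<^sub>R u)) \<partial>Q w)"
  proof (rule nn_integral_mono_AE)
    show "AE u in Q w. ennreal (q (z - r * u $ i)) \<le> ?F k (closest_point ?C (w - \<eta> *\<^sub>R u))"
      using neg[of w]
    proof eventually_elim
      case (elim u)
      have "r * u $ i \<ge> \<eta> * u $ i" "r * u $ i \<le> 0"
        using r elim by (auto simp: mult_le_0_iff)
      then have "min \<tau> (z - r * u $ i) \<le> closest_point ?C (w - \<eta> *\<^sub>R u) $ i"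
        using Suc.prems \<tau> by (auto simp: closest_point_cube_nth[OF D])
      from Suc.IH[OF this] show ?case unfolding q_def .
    qed
  qed
  also have "\<dots> = ?F (Suc k) w"
  proof -
    have [measurable]: "?F k \<in> borel_measurable borel"
      by (intro borel_measurable_reach_prob measurable_psgd_step Q C) measurable
    note borel_measurable_closest_point[OF C, measurable]
    show ?thesis by (simp add: psgd_step_def nn_integral_distr)
  qed
  finally show ?case .
qed

lemma reach_prob_ge:
  fixes Q :: "real^'d::finite \<Rightarrow> (real^'d) measure"
  assumes Q: "Q \<in> borel \<rightarrow>\<^sub>M prob_algebra borel"
    and neg: "\<And>w. AE u in Q w. u $ i < 0"
    and int1: "\<And>w. integrable (Q w) (\<lambda>u. u $ i)"
    and int2: "\<And>w. integrable (Q w) (\<lambda>u. (u $ i)\<^sup>2)"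
    and mean: "\<And>w. (\<integral>u. u $ i \<partial>Q w) \<le> - g"
    and second: "\<And>w. (\<integral>u. (u $ i)\<^sup>2 \<partial>Q w) \<le> C * (\<integral>u. u $ i \<partial>Q w)\<^sup>2"
    and pos: "g > 0" "\<eta> > 0"
    and \<tau>: "0 < \<tau>" "\<tau> \<le> D" "\<tau> \<le> T * (\<eta> * g) / 2"
    and w: "0 \<le> w $ i"
  shows "ennreal (1 / (4 * C))
         \<le> reach_prob (psgd_step Q \<eta> (cbox (\<chi> i. - D) (\<chi> i. D))) {x. \<tau> \<le> x $ i} T w"
proof -
  \<comment> \<open>The second-moment condition at any single point, here \<open>0\<close>, forces \<open>C \<ge> 1\<close>.\<close>
  have "Q 0 \<in> space (prob_algebra borel)"
    using measurable_space[OF Q] by simp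
  then interpret prob_space "Q 0" by (simp add: space_prob_algebra)
  have e: "(\<integral>u. u $ i \<partial>Q 0)\<^sup>2 > 0" using mean[of 0] pos by auto
  have "0 \<le> (\<integral>u. (u $ i)\<^sup>2 \<partial>Q 0) - (\<integral>u. u $ i \<partial>Q 0)\<^sup>2"
    using variance_positive[of "\<lambda>u. u $ i"] variance_eq[OF int1 int2] by simp
  with second[of 0] have "1 * (\<integral>u. u $ i \<partial>Q 0)\<^sup>2 \<le> C * (\<integral>u. u $ i \<partial>Q 0)\<^sup>2" by simp
  then have C: "C \<ge> 1" using e by (simp only: mult_le_cancel_right)
  define m where "m = \<eta> * g"
  define M where "M = T * m"
  have m: "m > 0" using pos by (simp add: m_def)
  have M: "M > 0" "\<tau> \<le> M / 2" using \<tau> by (simp_all add: m_def M_def)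
  \<comment> \<open>This \<open>l\<close> maximises \<open>2l(M - M/2) - l\<^sup>2 C M\<^sup>2\<close>; the maximum is \<open>1 / (4C)\<close>.\<close>
  define l where "l = 1 / (2 * C * M)"
  have l: "l \<ge> 0" using C M by (simp add: l_def)
  have "1 / (4 * C) = 2 * l * (M - M / 2) - l\<^sup>2 * (C * M\<^sup>2)"
    using C M by (simp add: l_def power2_eq_square field_simps)
  also have "\<dots> \<le> 2 * l * (M - M / 2) - l\<^sup>2 * (T * C * m\<^sup>2 + T * (real T - 1) * m\<^sup>2)"
  proof -
    have "T * (real T - 1) \<le> C * (T * (real T - 1))"
    proof (cases T)
      case (Suc n)
      then show ?thesis using mult_right_mono[OF C, of "T * (real T - 1)"] by simp
    qed simp
    then have "(T * C + T * (real T - 1)) * m\<^sup>2 \<le> (T * C + C * (T * (real T - 1))) * m\<^sup>2"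
      by (intro mult_right_mono) auto
    also have "\<dots> = C * M\<^sup>2" by (simp add: M_def power2_eq_square algebra_simps)
    finally show ?thesis by (intro diff_left_mono mult_left_mono) (auto simp: algebra_simps)
  qed
  finally have "ennreal (1 / (4 * C)) \<le>
      ennreal (2 * l * (M - M / 2) - l\<^sup>2 * (T * C * m\<^sup>2 + T * (real T - 1) * m\<^sup>2))"
    by (rule ennreal_leI)
  also have "\<dots> \<le> reach_prob (psgd_step Q \<eta> (cbox (\<chi> i. - D) (\<chi> i. D))) {x. \<tau> \<le> x $ i} T w"
    using reach_prob_ge_quadratic[OF Q neg int1 int2 mean second pos l \<tau>(1,2) M(2) _ m_def, of 0 w T] w \<tau>(1)
    by (simp add: M_def)
  finally show ?thesis .
qed

section \<open>Gaussian estimates\<close>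

text \<open>On the domain of integration \<open>1 \<le> x / \<tau>\<close>, and \<open>x / \<tau>\<close> times the density has an elementary
  antiderivative.\<close>

lemma normal_tail_le:
  assumes "\<sigma> > 0" "\<tau> > 0"
  shows "emeasure (density lborel (normal_density 0 \<sigma>)) {\<tau>..}
         \<le> ennreal (\<sigma> / (\<tau> * sqrt (2 * pi)) * exp (- \<tau>\<^sup>2 / (2 * \<sigma>\<^sup>2)))"
proof -
  let ?F = "\<lambda>x. - (\<sigma>\<^sup>2 / \<tau>) * normal_density 0 \<sigma> x"
  have "emeasure (density lborel (normal_density 0 \<sigma>)) {\<tau>..}
      = (\<integral>\<^sup>+x. ennreal (normal_density 0 \<sigma> x) * indicator {\<tau>..} x \<partial>lborel)"
    by (simp add: emeasure_density)
  also have "\<dots> \<le> (\<integral>\<^sup>+x. ennreal (x / \<tau> * normal_density 0 \<sigma> x) * indicator {\<tau>..} x \<partial>lborel)"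
  proof (intro nn_integral_mono)
    fix x :: real
    show "ennreal (normal_density 0 \<sigma> x) * indicator {\<tau>..} x
        \<le> ennreal (x / \<tau> * normal_density 0 \<sigma> x) * indicator {\<tau>..} x"
      using assms mult_right_mono[of 1 "x / \<tau>" "normal_density 0 \<sigma> x"]
      by (auto simp: indicator_def normal_density_nonneg intro!: ennreal_leI)
  qed
  also have "\<dots> = ennreal (0 - ?F \<tau>)"
  proof (rule nn_integral_FTC_atLeast[where F = ?F])
    fix x :: real
    show "DERIV ?F x :> x / \<tau> * normal_density 0 \<sigma> x"
      unfolding normal_density_def using assms
      by (auto intro!: derivative_eq_intros simp: field_simps power2_eq_square)
    show "\<tau> \<le> x \<Longrightarrow> 0 \<le> x / \<tau> * normal_density 0 \<sigma> x"
      using assms by (simp add: normal_density_nonneg)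
    have "((\<lambda>x. exp (- x\<^sup>2 / (2 * \<sigma>\<^sup>2))) \<longlongrightarrow> 0) at_top"
      using assms by real_asymp
    then have "((\<lambda>x. - (\<sigma>\<^sup>2 / \<tau>) * (1 / sqrt (2 * pi * \<sigma>\<^sup>2) * exp (- (x - 0)\<^sup>2 / (2 * \<sigma>\<^sup>2)))) \<longlongrightarrow>
        - (\<sigma>\<^sup>2 / \<tau>) * (1 / sqrt (2 * pi * \<sigma>\<^sup>2) * 0)) at_top"
      by (intro tendsto_mult tendsto_const) simp
    then show "(?F \<longlongrightarrow> 0) at_top" unfolding normal_density_def by simp
  qed measurable
  also have "0 - ?F \<tau> = \<sigma> / (\<tau> * sqrt (2 * pi)) * exp (- \<tau>\<^sup>2 / (2 * \<sigma>\<^sup>2))"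
    using assms by (simp add: normal_density_def real_sqrt_mult power2_eq_square field_simps)
  finally show ?thesis .
qed

lemma normal_atLeast_0_ge:
  assumes "\<sigma> > 0"
  shows "emeasure (density lborel (normal_density 0 \<sigma>)) {0..} \<ge> ennreal (1 / 2)"
proof -
  let ?N = "density lborel (normal_density 0 \<sigma>)"
  interpret prob_space ?N by (rule prob_space_normal_density[OF assms])
  have "emeasure ?N {..0} = (\<integral>\<^sup>+x. ennreal (normal_density 0 \<sigma> x) * indicator {..0} x \<partial>lborel)"
    by (simp add: emeasure_density)
  also have "\<dots> = (\<integral>\<^sup>+x. ennreal (normal_density 0 \<sigma> (- x)) * indicator {..0} (- x) \<partial>lborel)"
    by (subst nn_integral_real_affine[where c = "- 1" and t = 0]) simp_all
  also have "\<dots> = (\<integral>\<^sup>+x. ennreal (normal_density 0 \<sigma> x) * indicator {0..} x \<partial>lborel)"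
    by (intro nn_integral_cong) (auto simp: normal_density_def indicator_def)
  also have "\<dots> = emeasure ?N {0..}"
    by (simp add: emeasure_density)
  finally have "prob {..0} = prob {0..}" by (simp add: measure_def)
  moreover have "1 \<le> prob {..0} + prob {0..}"
  proof -
    have "{..0} \<union> {0..} = (UNIV :: real set)" by auto
    then show ?thesis using measure_Un_le[of "{..0}" ?N "{0..}"] prob_space by simp
  qed
  ultimately have "1 / 2 \<le> prob {0..}" by simp
  then show ?thesis unfolding emeasure_eq_measure by (rule ennreal_leI)
qed

lemma borel_measurable_vec_lambda_PiM:
  assumes "\<And>i. sets (M i) = sets borel"
  shows "(\<lambda>x. \<chi> i. x i) \<in> (\<Pi>\<^sub>M i\<in>UNIV. M i) \<rightarrow>\<^sub>M (borel :: (real^'d::finite) measure)"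
proof -
  have "(\<lambda>x. x i) \<in> (\<Pi>\<^sub>M i\<in>(UNIV :: 'd set). M i) \<rightarrow>\<^sub>M borel" for i
    using measurable_component_singleton[of i UNIV M]
    by (simp add: measurable_cong_sets[OF refl assms])
  then show ?thesis
    by (subst borel_measurable_euclidean_space) (auto simp: Basis_vec_def inner_axis)
qed

lemma isotropic_gaussian_in_prob_algebra:
  assumes "\<sigma> > 0"
  shows "(isotropic_gaussian \<sigma> :: (real^'d::finite) measure) \<in> space (prob_algebra borel)"
proof -
  let ?N = "density lborel (\<lambda>x. ennreal (normal_density 0 \<sigma> x))"
  interpret prob_space "\<Pi>\<^sub>M i\<in>(UNIV::'d set). ?N"
    by (intro prob_space_PiM prob_space_normal_density assms)
  show ?thesis
    unfolding isotropic_gaussian_def space_prob_algebra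
    by (auto intro!: prob_space_distr borel_measurable_vec_lambda_PiM)
qed

lemma emeasure_isotropic_gaussian_halfspace:
  assumes "\<sigma> > 0"
  shows "emeasure (isotropic_gaussian \<sigma>) {x :: real^'d::finite. t \<le> x $ i}
       = emeasure (density lborel (normal_density 0 \<sigma>)) {t..}"
proof -
  let ?N = "density lborel (\<lambda>x. ennreal (normal_density 0 \<sigma> x))"
  let ?P = "\<Pi>\<^sub>M i\<in>(UNIV::'d set). ?N"
  have m: "(\<lambda>x. \<chi> i. x i) \<in> ?P \<rightarrow>\<^sub>M (borel :: (real^'d) measure)"
    by (rule borel_measurable_vec_lambda_PiM) simp
  have "emeasure (isotropic_gaussian \<sigma>) {x :: real^'d. t \<le> x $ i}
      = emeasure ?P ((\<lambda>x. x i) -` {t..} \<inter> space ?P)"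
    unfolding isotropic_gaussian_def
    by (subst emeasure_distr[OF m]) (auto intro!: arg_cong[where f = "emeasure ?P"])
  also have "\<dots> = emeasure (distr ?P ?N (\<lambda>x. x i)) {t..}"
    by (subst emeasure_distr) auto
  also have "distr ?P ?N (\<lambda>x. x i) = ?N"
    using distr_PiM_component[of UNIV "\<lambda>_. ?N" i] prob_space_normal_density[OF assms] by simp
  finally show ?thesis .
qed

section \<open>The lower bound\<close>

lemma PiM_singleton_moments:
  fixes f :: "'a \<Rightarrow> real"
  assumes "prob_space M" "f \<in> borel_measurable M"
  shows "integrable (PiM {j} (\<lambda>_. M)) (\<lambda>u. f (u j)) = integrable M f"
    and "(\<integral>u. f (u j) \<partial>PiM {j} (\<lambda>_. M)) = (\<integral>x. f x \<partial>M)"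
proof -
  have d: "distr (PiM {j} (\<lambda>_. M)) M (\<lambda>u. u j) = M"
    using distr_PiM_component[of "{j}" "\<lambda>_. M" j] assms(1) by simp
  have "integrable (distr (PiM {j} (\<lambda>_. M)) M (\<lambda>u. u j)) f = integrable (PiM {j} (\<lambda>_. M)) (\<lambda>u. f (u j))"
    by (rule integrable_distr_eq) (use assms in auto)
  then show "integrable (PiM {j} (\<lambda>_. M)) (\<lambda>u. f (u j)) = integrable M f"
    unfolding d by simp
  have "integral\<^sup>L (distr (PiM {j} (\<lambda>_. M)) M (\<lambda>u. u j)) f = (\<integral>u. f (u j) \<partial>PiM {j} (\<lambda>_. M))"
    by (rule integral_distr) (use assms in auto)
  then show "(\<integral>u. f (u j) \<partial>PiM {j} (\<lambda>_. M)) = (\<integral>x. f x \<partial>M)"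
    unfolding d by simp
qed

text \<open>If all updates vanish, the iterate is just projected repeatedly, which preserves
  membership in the half-space because \<open>- D < \<tau> \<le> D\<close>.\<close>

lemma emeasure_psgd_no_update:
  fixes orc :: "'d::finite update_oracle"
  assumes orc: "orc f \<in> borel \<rightarrow>\<^sub>M prob_algebra borel"
    and zero: "\<And>w. AE u in orc f w. u = 0"
    and R: "R \<in> space (prob_algebra borel)"
    and \<tau>: "0 < \<tau>" "\<tau> \<le> D"
  shows "emeasure (psgd orc f \<eta> (cbox (\<chi> i. - D) (\<chi> i. D)) R T) {x. \<tau> \<le> x $ i} = emeasure R {x. \<tau> \<le> x $ i}"
proof -
  let ?C = "cbox (\<chi> i. - D) (\<chi> i. D) :: (real^'d) set"
  let ?S = "{x :: real^'d. \<tau> \<le> x $ i}"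
  have D: "D \<ge> 0" using \<tau> by simp
  have C: "convex ?C" "closed ?C" "?C \<noteq> {}"
    using D by (auto simp: interval_ne_empty_cart)
  note borel_measurable_closest_point[OF C, measurable]
  have S[measurable]: "?S \<in> sets borel" by measurable
  have step: "(\<integral>\<^sup>+y. indicator ?S y \<partial>psgd_step (orc f) \<eta> ?C w) = indicator ?S w" for w
  proof -
    have "orc f w \<in> space (prob_algebra borel)" using measurable_space[OF orc] by simp
    then interpret prob_space "orc f w" by (simp add: space_prob_algebra)
    have [measurable_cong]: "sets (orc f w) = sets borel"
      using \<open>orc f w \<in> _\<close> by (simp add: space_prob_algebra)
    have "(\<integral>\<^sup>+y. indicator ?S y \<partial>psgd_step (orc f) \<eta> ?C w)
        = (\<integral>\<^sup>+u. indicator ?S (closest_point ?C (w - \<eta> *\<^sub>R u)) \<partial>orc f w)"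
      unfolding psgd_step_def by (rule nn_integral_distr) measurable
    also have "\<dots> = (\<integral>\<^sup>+u. indicator ?S w \<partial>orc f w)"
    proof (rule nn_integral_cong_AE)
      show "AE u in orc f w. indicator ?S (closest_point ?C (w - \<eta> *\<^sub>R u)) = (indicator ?S w :: ennreal)"
        using zero[of w]
        by eventually_elim (use \<tau> in \<open>auto simp: indicator_def closest_point_cube_nth[OF D]\<close>)
    qed
    finally show ?thesis by (simp add: emeasure_space_1)
  qed
  have "reach_prob (psgd_step (orc f) \<eta> ?C) ?S k = indicator ?S" for k
    by (induction k) (auto simp: fun_eq_iff step simp del: nn_integral_indicator)
  then show ?thesis
    using R S
    by (simp add: emeasure_psgd_eq_reach_prob[of orc f, OF orc C R S] space_prob_algebra)
qed

theorem theorem4p5: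
  fixes orc :: "'d::finite update_oracle"
    and n :: nat
    and L \<eta> \<sigma> C\<^sub>s D :: real
  assumes "n \<ge> 1"
    and "L > 0" and "\<eta> > 0" and "\<sigma> > 0" and "C\<^sub>s > 0"
    and "D > \<eta> * L / (2 * real n)"
    and "is_oracle orc"
    and "anti_concentrated L C\<^sub>s orc"
  shows "\<exists>(U :: nat set) (loss :: real^'d \<Rightarrow> nat list \<Rightarrow> real).
    (\<forall>X \<in> datasets U n.
        linear (\<lambda>w. loss w X) \<and>
        L-lipschitz_on (cbox (\<chi> i. - D) (\<chi> i. D)) (\<lambda>w. loss w X)) \<and>
    (\<forall>T::nat. T \<ge> 1 \<longrightarrow>
      (\<forall>\<epsilon> \<delta> :: real. \<epsilon> \<ge> 0 \<and> 0 \<le> \<delta> \<and> \<delta> < 1 \<and>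
          \<delta> \<le> 1 / (16 * C\<^sub>s) * max (1 / real T powr (2/3)) (\<eta> * L / (2 * real n * D)) \<and>
          \<epsilon> \<le> min (\<eta>\<^sup>2 * L\<^sup>2 * real T powr (4/3) / (8 * (real n)\<^sup>2 * \<sigma>\<^sup>2)) (D\<^sup>2 / (2 * \<sigma>\<^sup>2))
               + ln (sqrt (2 * pi) * L * \<eta> / (64 * C\<^sub>s * real n * \<sigma>)) \<longrightarrow>
        \<not> differentially_private U n \<epsilon> \<delta>
            (\<lambda>X. psgd orc (\<lambda>w. loss w X) \<eta> (cbox (\<chi> i. - D) (\<chi> i. D)) (isotropic_gaussian \<sigma>) T)))"
proof -
  have orc: "orc f \<in> borel \<rightarrow>\<^sub>M prob_algebra borel" for f
    using assms(7) by (simp add: is_oracle_def)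
  from assms(8) obtain i where ac: "\<And>h w\<^sub>0. h \<in> lin_class L i \<Longrightarrow>
        (gradient h w\<^sub>0 $ i = 0 \<longrightarrow> \<P>(u in orc h w\<^sub>0. u = 0) = 1) \<and>
        (gradient h w\<^sub>0 $ i \<noteq> 0 \<longrightarrow> \<P>(u in orc h w\<^sub>0. u $ i < 0) = 1) \<and>
        integrable (orc h w\<^sub>0) (\<lambda>u. u $ i) \<and>
        (\<integral>u. u $ i \<partial>orc h w\<^sub>0) \<le> gradient h w\<^sub>0 $ i \<and>
        (\<forall>(N::nat) (w :: nat \<Rightarrow> real^'d).
           let P = (\<Pi>\<^sub>M j\<in>{1..N}. orc h (w j)) in
             integrable P (\<lambda>u. \<Sum>j=1..N. u j $ i) \<and>
             integrable P (\<lambda>u. (\<Sum>j=1..N. u j $ i)\<^sup>2) \<and>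
             (\<integral>u. (\<Sum>j=1..N. u j $ i)\<^sup>2 \<partial>P) \<le> C\<^sub>s * (\<integral>u. (\<Sum>j=1..N. u j $ i) \<partial>P)\<^sup>2)"
    unfolding anti_concentrated_def by blast
  define c where "c X = - (L / n) * count_list X (1::nat)" for X
  define loss :: "real^'d \<Rightarrow> nat list \<Rightarrow> real" where
    "loss w X = (c X *\<^sub>R axis i 1) \<bullet> w" for w X
  define U :: "nat set" where "U = {0, 1}"
  define X where "X = replicate n (0::nat)"
  define Y where "Y = 1 # replicate (n - 1) (0::nat)"
  define g where "g = L / n"
  define m where "m = \<eta> * g"
  have n: "n > 0" using assms(1) by simp
  have g: "g > 0" "g \<le> L" using n assms(1,2) by (auto simp: g_def field_simps)
  have m: "m > 0" "m / 2 < D" using g assms(3,6) by (simp_all add: m_def, simp add: g_def mult.commute)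
  have D: "D > 0" using m by simp
  have cX: "c X = 0" by (simp add: c_def X_def count_list_0_iff)
  have cY: "c Y = - g" by (simp add: c_def Y_def g_def count_list_0_iff)
  let ?C = "cbox (\<chi> i. - D) (\<chi> i. D) :: (real^'d) set"
  let ?R = "isotropic_gaussian \<sigma> :: (real^'d) measure"
  let ?A = "\<lambda>T X. psgd orc (\<lambda>w. loss w X) \<eta> ?C ?R T"
  have C: "convex ?C" "closed ?C" "?C \<noteq> {}"
    using D by (auto simp: interval_ne_empty_cart)
  have R: "?R \<in> space (prob_algebra borel)"
    by (rule isotropic_gaussian_in_prob_algebra[OF assms(4)])
  have XY: "X \<in> datasets U n" "Y \<in> datasets U n" "neighbouring Y X"
  proof -
    have "replicate n (0::nat) = 0 # replicate (n - 1) 0" using n by (cases n) auto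
    then show "X \<in> datasets U n" "Y \<in> datasets U n" "neighbouring Y X"
      using n by (auto simp: X_def Y_def datasets_def U_def neighbouring_def)
  qed
  have loss: "linear (\<lambda>w. loss w Z) \<and> L-lipschitz_on ?C (\<lambda>w. loss w Z)" if "Z \<in> datasets U n" for Z
  proof
    show lin: "linear (\<lambda>w. loss w Z)"
      by (auto simp: loss_def intro!: linearI simp: inner_add_right distrib_left)
    have "count_list Z 1 \<le> n" using that count_le_length[of Z 1] by (simp add: datasets_def)
    then have cZ: "\<bar>c Z\<bar> \<le> L" using n assms(2) by (simp add: c_def abs_mult field_simps)
    show "L-lipschitz_on ?C (\<lambda>w. loss w Z)"
    proof (rule lipschitz_onI)
      fix v w :: "real^'d"
      have "dist (loss v Z) (loss w Z) = \<bar>(c Z *\<^sub>R axis i 1) \<bullet> (v - w)\<bar>"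
        by (simp add: dist_real_def loss_def inner_diff_right)
      also have "\<dots> \<le> norm (c Z *\<^sub>R axis i 1 :: real^'d) * norm (v - w)"
        by (rule Cauchy_Schwarz_ineq2)
      also have "\<dots> \<le> L * norm (v - w)"
        using cZ by (intro mult_right_mono) auto
      finally show "dist (loss v Z) (loss w Z) \<le> L * dist v w" by (simp add: dist_norm)
    qed (use assms in simp)
  qed
  have prob: "prob_space (orc f w)" and sets_orc[measurable_cong]: "sets (orc f w) = sets borel" for f w
    using measurable_space[OF orc, of w f] by (auto simp: space_prob_algebra)
  have space_orc: "space (orc f w) = UNIV" for f w
    using sets_eq_imp_space_eq[OF sets_orc[of f w]] by simp

  have not_dp: "\<not> differentially_private U n \<epsilon> \<delta> (?A T)"
    if T: "T \<ge> 1"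
      and \<delta>: "\<delta> \<le> 1 / (16 * C\<^sub>s) * max (1 / real T powr (2/3)) (\<eta> * L / (2 * real n * D))"
      and \<epsilon>: "\<epsilon> \<le> min (\<eta>\<^sup>2 * L\<^sup>2 * real T powr (4/3) / (8 * (real n)\<^sup>2 * \<sigma>\<^sup>2)) (D\<^sup>2 / (2 * \<sigma>\<^sup>2))
               + ln (sqrt (2 * pi) * L * \<eta> / (64 * C\<^sub>s * real n * \<sigma>))" for T \<epsilon> \<delta>
  proof
    assume dp: "differentially_private U n \<epsilon> \<delta> (?A T)"
    define b where "b = real T powr (2/3)"
    have b: "1 \<le> b" "b \<le> T"
    proof -
      show "1 \<le> b" using T by (simp add: b_def ge_one_powr_ge_zero)
      show "b \<le> T" using T powr_mono[of "2/3" 1 "real T"] by (simp add: b_def)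
    qed
    define \<tau> where "\<tau> = min D (m * b / 2)"
    have \<tau>: "0 < \<tau>" "\<tau> \<le> D" "\<tau> \<le> T * (\<eta> * g) / 2"
    proof -
      show "0 < \<tau>" "\<tau> \<le> D" using D m b by (auto simp: \<tau>_def)
      have "\<tau> \<le> m * b / 2" by (simp add: \<tau>_def)
      also have "\<dots> \<le> m * T / 2" using m b by (intro divide_right_mono mult_left_mono) auto
      finally show "\<tau> \<le> T * (\<eta> * g) / 2" by (simp add: m_def mult.commute)
    qed
    have \<tau>2: "m / (2 * \<tau>) \<le> 1"
      using \<tau>(1) m b by (auto simp: \<tau>_def min_def field_simps)
    let ?S = "{x :: real^'d. \<tau> \<le> x $ i}"
    have S[measurable]: "?S \<in> sets borel" by measurable

    have PX: "measure (?A T X) ?S \<le> \<sigma> / (\<tau> * sqrt (2 * pi)) * exp (- \<tau>\<^sup>2 / (2 * \<sigma>\<^sup>2))"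
    proof -
      have "(\<lambda>w. loss w X) \<in> lin_class L i"
        using assms(2) by (auto simp: lin_class_def loss_def cX intro!: exI[of _ 0])
      moreover have "gradient (\<lambda>w. loss w X) w $ i = 0" for w
        unfolding loss_def gradient_inner_left cX by simp
      ultimately have "\<P>(u in orc (\<lambda>w. loss w X) w. u = 0) = 1" for w
        using ac by blast
      then have "AE u in orc (\<lambda>w. loss w X) w. u = 0" for w
        by (subst (asm) prob_space.prob_Collect_eq_1[OF prob]) auto
      from emeasure_psgd_no_update[of orc, OF orc this R \<tau>(1,2)]
      have "emeasure (?A T X) ?S = emeasure ?R ?S" .
      also have "\<dots> \<le> ennreal (\<sigma> / (\<tau> * sqrt (2 * pi)) * exp (- \<tau>\<^sup>2 / (2 * \<sigma>\<^sup>2)))"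
        using normal_tail_le[OF assms(4) \<tau>(1)]
        by (simp add: emeasure_isotropic_gaussian_halfspace[OF assms(4)])
      finally show ?thesis
        using assms(4) \<tau>(1) by (simp add: measure_def enn2real_leI)
    qed

    have PY: "measure (?A T Y) ?S \<ge> 1 / (8 * C\<^sub>s)"
    proof -
      let ?h = "\<lambda>w. loss w Y"
      let ?Q = "orc ?h"
      have h: "?h \<in> lin_class L i"
        using g by (auto simp: lin_class_def loss_def cY intro!: exI[of _ "- g"])
      have grad: "gradient ?h w $ i = - g" for w
        unfolding loss_def gradient_inner_left cY by simp
      note acY = ac[OF h, unfolded grad]
      have neg: "AE u in ?Q w. u $ i < 0" for w
        using acY[of w] g by (subst (asm) prob_space.prob_Collect_eq_1[OF prob]) auto
      \<comment> \<open>The case \<open>N = 1\<close> of the second-moment condition, at an arbitrary point.\<close>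
      have one: "integrable (PiM {1::nat} (\<lambda>_. ?Q w)) (\<lambda>u. (u 1 $ i)\<^sup>2)"
          "(\<integral>u. (u 1 $ i)\<^sup>2 \<partial>PiM {1::nat} (\<lambda>_. ?Q w)) \<le> C\<^sub>s * (\<integral>u. u 1 $ i \<partial>PiM {1::nat} (\<lambda>_. ?Q w))\<^sup>2" for w
        using acY[of w, THEN conjunct2, THEN conjunct2, THEN conjunct2, THEN conjunct2,
            THEN spec[of _ 1], THEN spec[of _ "\<lambda>_. w"]]
        by (auto simp: Let_def)
      have int2: "integrable (?Q w) (\<lambda>u. (u $ i)\<^sup>2)" for w
        using one(1)[of w] by (subst (asm) PiM_singleton_moments(1)[OF prob]) measurable
      have second: "(\<integral>u. (u $ i)\<^sup>2 \<partial>?Q w) \<le> C\<^sub>s * (\<integral>u. u $ i \<partial>?Q w)\<^sup>2" for w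
        using one(2)[of w]
        by (subst (asm) PiM_singleton_moments(2)[OF prob], measurable)+
      have reach: "ennreal (1 / (4 * C\<^sub>s)) \<le> reach_prob (psgd_step ?Q \<eta> ?C) ?S T w" if "0 \<le> w $ i" for w
        using acY by (intro reach_prob_ge[OF orc neg _ int2 _ second g(1) assms(3) \<tau> that]) auto
      have sR: "sets ?R = sets borel" using R by (simp add: space_prob_algebra)
      have "ennreal (1 / (8 * C\<^sub>s)) = ennreal (1 / (4 * C\<^sub>s)) * ennreal (1 / 2)"
        using assms(5) by (subst ennreal_mult[symmetric]) auto
      also have "\<dots> \<le> ennreal (1 / (4 * C\<^sub>s)) * emeasure ?R {x. 0 \<le> x $ i}"
        using normal_atLeast_0_ge[OF assms(4)]
        by (intro mult_left_mono) (simp_all add: emeasure_isotropic_gaussian_halfspace[OF assms(4)])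
      also have "\<dots> = (\<integral>\<^sup>+w. ennreal (1 / (4 * C\<^sub>s)) * indicator {x. 0 \<le> x $ i} w \<partial>?R)"
        by (rule nn_integral_cmult_indicator[symmetric]) (simp add: sR)
      also have "\<dots> \<le> (\<integral>\<^sup>+w. reach_prob (psgd_step ?Q \<eta> ?C) ?S T w \<partial>?R)"
        using reach by (intro nn_integral_mono) (auto simp: indicator_def)
      also have "\<dots> = emeasure (?A T Y) ?S"
        by (rule emeasure_psgd_eq_reach_prob[of orc, OF orc C R S, symmetric])
      finally have le: "ennreal (1 / (8 * C\<^sub>s)) \<le> emeasure (?A T Y) ?S" .
      have "prob_space (?A T Y)"
        using psgd_in_prob_algebra[of orc, OF orc C R] by (simp add: space_prob_algebra)
      then interpret prob_space "?A T Y" .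
      from le show ?thesis by (simp add: emeasure_eq_measure)
    qed

    \<comment> \<open>\<open>\<tau>\<close> is chosen so that the minimum in the bound on \<open>\<epsilon>\<close> is \<open>\<tau>\<^sup>2 / (2\<sigma>\<^sup>2)\<close> and the maximum
      in the bound on \<open>\<delta>\<close> is \<open>m / (2\<tau>)\<close>.\<close>
    have exp_le: "exp \<epsilon> \<le> exp (\<tau>\<^sup>2 / (2 * \<sigma>\<^sup>2)) * (sqrt (2 * pi) * m / (64 * C\<^sub>s * \<sigma>))"
    proof -
      have mb: "(m * b / 2)\<^sup>2 = \<eta>\<^sup>2 * L\<^sup>2 * real T powr (4/3) / (4 * (real n)\<^sup>2)"
      proof -
        have "b\<^sup>2 = real T powr (4/3)"
          using T by (simp add: b_def powr_powr[symmetric] powr_realpow[symmetric] power2_eq_square powr_add[symmetric])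
        then show ?thesis by (simp add: m_def g_def power_mult_distrib power_divide)
      qed
      have "\<tau>\<^sup>2 = min (D\<^sup>2) ((m * b / 2)\<^sup>2)"
        using D m b by (auto simp: \<tau>_def min_def power_mono dest!: power2_le_imp_le intro: antisym)
      then have "\<tau>\<^sup>2 / (2 * \<sigma>\<^sup>2) = min (D\<^sup>2 / (2 * \<sigma>\<^sup>2)) ((m * b / 2)\<^sup>2 / (2 * \<sigma>\<^sup>2))"
        using assms(4) by (simp add: min_divide_distrib_right)
      also have "(m * b / 2)\<^sup>2 / (2 * \<sigma>\<^sup>2) = \<eta>\<^sup>2 * L\<^sup>2 * real T powr (4/3) / (8 * (real n)\<^sup>2 * \<sigma>\<^sup>2)"
        unfolding mb by simp
      finally have "\<epsilon> \<le> \<tau>\<^sup>2 / (2 * \<sigma>\<^sup>2) + ln (sqrt (2 * pi) * m / (64 * C\<^sub>s * \<sigma>))"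
        using \<epsilon> by (simp add: min.commute m_def g_def mult_ac)
      then have "exp \<epsilon> \<le> exp (\<tau>\<^sup>2 / (2 * \<sigma>\<^sup>2) + ln (sqrt (2 * pi) * m / (64 * C\<^sub>s * \<sigma>)))" by simp
      then show ?thesis using m assms(4,5) by (simp add: exp_add)
    qed
    have \<delta>_le: "\<delta> \<le> m / (32 * C\<^sub>s * \<tau>)"
    proof -
      have "max (1 / b) (m / (2 * D)) = m / (2 * \<tau>)"
        using D m b by (auto simp: \<tau>_def max_def min_def field_simps)
      then have "\<delta> \<le> 1 / (16 * C\<^sub>s) * (m / (2 * \<tau>))"
        using \<delta> by (simp add: b_def m_def g_def mult_ac)
      then show ?thesis by simp
    qed
    have "1 / (8 * C\<^sub>s) \<le> measure (?A T Y) ?S" by (rule PY)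
    also have "\<dots> \<le> exp \<epsilon> * measure (?A T X) ?S + \<delta>"
      using dp XY S unfolding differentially_private_def by blast
    also have "exp \<epsilon> * measure (?A T X) ?S \<le>
        (exp (\<tau>\<^sup>2 / (2 * \<sigma>\<^sup>2)) * (sqrt (2 * pi) * m / (64 * C\<^sub>s * \<sigma>))) *
        (\<sigma> / (\<tau> * sqrt (2 * pi)) * exp (- \<tau>\<^sup>2 / (2 * \<sigma>\<^sup>2)))"
      using exp_le PX assms(4,5) m by (intro mult_mono) auto
    also have "\<dots> = (exp (\<tau>\<^sup>2 / (2 * \<sigma>\<^sup>2)) * exp (- (\<tau>\<^sup>2 / (2 * \<sigma>\<^sup>2)))) * (m / (64 * C\<^sub>s * \<tau>))"
      using assms(4,5) \<tau>(1) by (simp add: field_simps)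
    also have "\<dots> = m / (64 * C\<^sub>s * \<tau>)" by (simp add: exp_minus)
    also have "m / (64 * C\<^sub>s * \<tau>) + \<delta> \<le> m / (64 * C\<^sub>s * \<tau>) + m / (32 * C\<^sub>s * \<tau>)"
      using \<delta>_le by simp
    also have "\<dots> = 3 / (32 * C\<^sub>s) * (m / (2 * \<tau>))"
      using assms(5) \<tau>(1) by (simp add: field_simps)
    also have "\<dots> \<le> 3 / (32 * C\<^sub>s) * 1"
      using \<tau>2 assms(5) by (intro mult_left_mono) auto
    finally show False using assms(5) by (simp add: field_simps)
  qed
  show ?thesis
    using loss not_dp by (intro exI[of _ U] exI[of _ loss]) blast
qed

end
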